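(* For every integer $n\ge1$, $$\sum_{i=1}^{n}(-1)^{i-1}\,i!\,S(n,i)=\begin{cases}0,& n\ \text{even},\\ \Theta(n,1),& n\ \text{odd},\end{cases}\qquad\leftrightarrow\qquad 2^{n-1}=\sum_{i=1}^n i!\,\Theta(n,i).$$ That is, both identities hold, and they form a pair of inverse relations: they are the $m=1$ cases of the inverse pair $\Theta(n,m)=\sum_i\overline{L}(i,m)\,S(n,i)\leftrightarrow S(n,m)=\sum_i\overline{l}(i,m)\,\Theta(n,i)$.
   Context: $S(n,i)=2^{n-i}\cdot$(Stirling number of the second kind, i.e. the number of partitions of an $n$-set into $i$ nonempty blocks). $\Theta(n,m)$ is defined by $\sum_n\Theta(n,m)\frac{u^n}{n!}=\frac1{m!}\tanh^m u$; in particular $\Theta(n,1)$ is the coefficient of $u^n/n!$ in $\tanh u$. The scaled Lah numbers are $\overline{l}(n,m)=\frac{n!}{m!}\binom{n-1}{m-1}$ and $\overline{L}(n,m)=(-1)^{n-m}\,\overline{l}(n,m)$ for $n,m\ge1$; they are inverse to each other: $\sum_i\overline{l}(n,i)\overline{L}(i,m)=\sum_i\overline{L}(n,i)\overline{l}(i,m)=[m=n]$, which equals $1$ if $m=n$ and $0$ otherwise. The symbol $\leftrightarrow$ joins two relations that are inverse to each other through such orthogonality relations. *)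

theory Defs
  imports
    Complex_Main
    "HOL-Combinatorics.Stirling"
    "HOL-Computational_Algebra.Formal_Power_Series"
begin

(* Natural-number subtraction is harmless here: Stirling n i = 0 for i > n. *)
definition scaled_Stirling :: "nat \<Rightarrow> nat \<Rightarrow> real" where
  "scaled_Stirling n i = 2 ^ (n - i) * real (Stirling n i)"

definition fps_sinh :: "real fps" where
  "fps_sinh = fps_const (1 / 2) * (fps_exp 1 - fps_exp (- 1))"

definition fps_cosh :: "real fps" where
  "fps_cosh = fps_const (1 / 2) * (fps_exp 1 + fps_exp (- 1))"

definition fps_tanh :: "real fps" where
  "fps_tanh = fps_sinh / fps_cosh"

(* Coefficient of u^n / n! (not of u^n) in tanh(u)^m / m!. *)
definition Theta :: "nat \<Rightarrow> nat \<Rightarrow> real" where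
  "Theta n m = fact n * fps_nth (fps_const (1 / fact m) * fps_tanh ^ m) n"

(* The two scaled Lah arrays are only meant for n, m >= 1. For m > n >= 1 the binomial
   coefficient vanishes, so the truncated exponent n - m plays no role there. *)
definition Lah_l :: "nat \<Rightarrow> nat \<Rightarrow> real" where
  "Lah_l n m = fact n / fact m * real ((n - 1) choose (m - 1))"

definition Lah_L :: "nat \<Rightarrow> nat \<Rightarrow> real" where
  "Lah_L n m = (- 1) ^ (n - m) * Lah_l n m"

(* The arrays, indexed by n, m >= 1, are lower triangular where this is used, so the sums
   over all i >= 1 reduce to 1 <= i <= n. *)
definition orthogonal_arrays ::
    "(nat \<Rightarrow> nat \<Rightarrow> real) \<Rightarrow> (nat \<Rightarrow> nat \<Rightarrow> real) \<Rightarrow> bool" where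
  "orthogonal_arrays A B \<longleftrightarrow>
     (\<forall>n\<ge>1. \<forall>m\<ge>1.
        (\<Sum>i=1..n. A n i * B i m) = (if m = n then 1 else 0) \<and>
        (\<Sum>i=1..n. B n i * A i m) = (if m = n then 1 else 0))"

(* f is obtained from g through B, g is obtained from f through A, and the two
   transformations are inverse to each other by orthogonality of A and B. The summation
   index runs over the first index of A and B, and f n i, g n i vanish for i > n. *)
definition inverse_relations ::
    "(nat \<Rightarrow> nat \<Rightarrow> real) \<Rightarrow> (nat \<Rightarrow> nat \<Rightarrow> real) \<Rightarrow>
     (nat \<Rightarrow> nat \<Rightarrow> real) \<Rightarrow> (nat \<Rightarrow> nat \<Rightarrow> real) \<Rightarrow> bool" where
  "inverse_relations A B f g \<longleftrightarrow>
     orthogonal_arrays A B \<and>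
     (\<forall>n\<ge>1. \<forall>m\<ge>1. f n m = (\<Sum>i=1..n. B i m * g n i)) \<and>
     (\<forall>n\<ge>1. \<forall>m\<ge>1. g n m = (\<Sum>i=1..n. A i m * f n i))"

end

theory Submission
  imports Defs
begin

text \<open>
  All four arrays are of one kind: for a power series \<open>f\<close> without constant term, the coefficient
  of \<open>u ^ n / n!\<close> in \<open>f ^ m / m!\<close> is the \<open>(n, m)\<close> entry of the \<^emph>\<open>Bell matrix\<close> of \<open>f\<close>. Composition
  of series becomes multiplication of Bell matrices in reverse order (\<open>bell_compose\<close>), so each of the inverse
  relations is an identity between series read off coefficientwise.

  The scaled Stirling numbers are the Bell matrix of \<open>E = (exp (2 u) - 1) / 2\<close>, because
  \<open>E' = 1 + 2 E\<close> turns into their recurrence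
  (\<open>scaled_Stirling_bell\<close>). The numbers \<open>Theta\<close> are the Bell matrix of \<open>tanh\<close> by
  definition, and the two Lah arrays are the Bell matrices of the Moebius maps \<open>x / (1 - x)\<close> and
  \<open>x / (1 + x)\<close> (\<open>bell_moebius\<close>). These two maps are inverse to each other under composition, which is the
  orthogonality, and \<open>tanh = E / (1 + E)\<close>, equivalently \<open>E = tanh / (1 - tanh)\<close>, which is the pair
  of relations between \<open>Theta\<close> and the Stirling numbers. The two displayed identities are the
  column \<open>m = 1\<close>; the vanishing for even \<open>n\<close> is the oddness of \<open>tanh\<close>.
\<close>

section \<open>Bell matrices\<close>

definition bell :: "real fps \<Rightarrow> nat \<Rightarrow> nat \<Rightarrow> real" where
  "bell f n m = fact n / fact m * fps_nth (f ^ m) n"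

text \<open>Expanding \<open>(f \<circ> g) ^ m = f ^ m \<circ> g\<close> in powers of \<open>g\<close>; the factorials of the summation
  index cancel.\<close>

lemma bell_compose:
  assumes "fps_nth f 0 = 0" "fps_nth g 0 = 0" "m \<ge> 1"
  shows "bell (fps_compose f g) n m = (\<Sum>i=1..n. bell f i m * bell g n i)"
proof -
  have "fps_nth (fps_compose f g ^ m) n = fps_nth (fps_compose (f ^ m) g) n"
    using assms by (simp add: fps_compose_power)
  also have "\<dots> = (\<Sum>i=0..n. fps_nth (f ^ m) i * fps_nth (g ^ i) n)"
    by (simp add: fps_compose_nth)
  also have "\<dots> = (\<Sum>i=1..n. fps_nth (f ^ m) i * fps_nth (g ^ i) n)"
    using assms by (simp add: sum.atLeast_Suc_atMost fps_power_zeroth)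
  finally show ?thesis
    by (simp add: bell_def sum_distrib_left field_simps)
qed

lemma bell_fps_X: "bell fps_X n m = (if m = n then 1 else 0)"
  by (simp add: bell_def)

section \<open>Lah numbers and Moebius maps\<close>

definition moebius :: "real \<Rightarrow> real fps" where
  "moebius c = fps_X * inverse (1 - fps_const c * fps_X)"

lemma moebius_nth_0 [simp]: "fps_nth (moebius c) 0 = 0"
  by (simp add: moebius_def)

lemma moebius_mult: "moebius c * (1 - fps_const c * fps_X) = fps_X"
  by (simp add: moebius_def mult.assoc inverse_mult_eq_1)

lemma compose_moebius_mult:
  assumes "fps_nth g 0 = 0"
  shows "fps_compose (moebius c) g * (1 - fps_const c * g) = g"
proof -
  have "fps_compose (moebius c * (1 - fps_const c * fps_X)) g = g"
    using assms by (simp add: moebius_mult)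
  then show ?thesis
    using assms by (simp add: fps_compose_mult_distrib fps_compose_sub_distrib)
qed

lemma moebius_compose_moebius: "fps_compose (moebius c) (moebius (- c)) = fps_X"
proof -
  let ?g = "moebius (- c)" and ?h = "fps_compose (moebius c) (moebius (- c))"
  have g: "?g * (1 + fps_const c * fps_X) = fps_X"
    using moebius_mult[of "- c"] by (simp flip: fps_const_neg)
  \<comment> \<open>The last factor is \<open>1\<close>, written so that the denominators of \<open>?h\<close> and \<open>?g\<close> split off.\<close>
  have "?h = ?h * (1 + fps_const c * fps_X - fps_const c * (?g * (1 + fps_const c * fps_X)))"
    by (simp add: g)
  also have "\<dots> = ?h * (1 - fps_const c * ?g) * (1 + fps_const c * fps_X)"
    by (simp add: algebra_simps)
  also have "\<dots> = fps_X"
    by (simp add: compose_moebius_mult g)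
  finally show ?thesis .
qed

text \<open>Clearing the denominator of \<open>f = x / (1 - c x)\<close> gives \<open>f ^ (m + 1) = c x f ^ (m + 1) + x f ^ m\<close>,
  a Pascal rule weighted by \<open>c\<close>.\<close>

lemma moebius_power_nth:
  "fps_nth (moebius c ^ Suc m) (Suc n) = c ^ (n - m) * real (n choose m)"
proof (induction n arbitrary: m)
  have eq: "moebius c ^ Suc m = fps_X * (fps_const c * moebius c ^ Suc m + moebius c ^ m)" for m
  proof -
    have "moebius c ^ m * (moebius c * (1 - fps_const c * fps_X)) = moebius c ^ m * fps_X"
      by (simp add: moebius_mult)
    then show ?thesis by (simp add: algebra_simps)
  qed
  have rec: "fps_nth (moebius c ^ Suc m) (Suc n)
      = c * fps_nth (moebius c ^ Suc m) n + fps_nth (moebius c ^ m) n" for m n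
    by (subst eq) (simp del: power_Suc)
  {
    case 0
    show ?case
      by (subst rec) (cases m; simp add: fps_power_zeroth)
  next
    case (Suc n)
    show ?case
    proof (cases m)
      case 0
      then show ?thesis
        by (subst rec) (use Suc.IH[of 0] in simp)
    next
      case (Suc k)
      have "c * (c ^ (n - Suc k) * real (n choose Suc k)) = c ^ (n - k) * real (n choose Suc k)"
        by (cases "n > k") (simp_all add: binomial_eq_0 Suc_diff_Suc flip: power_Suc)
      then show ?thesis
        unfolding Suc rec[of "Suc k"] Suc.IH by (simp add: algebra_simps)
    qed
  }
qed

lemma bell_moebius:
  assumes "n \<ge> 1" "m \<ge> 1"
  shows "bell (moebius c) n m = c ^ (n - m) * Lah_l n m"
proof -
  obtain n' m' where "n = Suc n'" "m = Suc m'"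
    using assms by (metis Suc_le_D One_nat_def)
  then show ?thesis
    unfolding bell_def Lah_l_def by (simp add: moebius_power_nth del: power_Suc)
qed

lemma Lah_l_bell: "n \<ge> 1 \<Longrightarrow> m \<ge> 1 \<Longrightarrow> Lah_l n m = bell (moebius 1) n m"
  by (simp add: bell_moebius)

lemma Lah_L_bell: "n \<ge> 1 \<Longrightarrow> m \<ge> 1 \<Longrightarrow> Lah_L n m = bell (moebius (- 1)) n m"
  by (simp add: bell_moebius Lah_L_def)

lemma orthogonal_Lah: "orthogonal_arrays Lah_l Lah_L"
proof -
  have "(\<Sum>i=1..n. bell (moebius (- c)) n i * bell (moebius c) i m) = (if m = n then 1 else 0)"
    if "m \<ge> 1" for c n m
    using bell_compose[of "moebius c" "moebius (- c)" m n] that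
    by (simp add: moebius_compose_moebius bell_fps_X mult.commute)
  from this[of _ 1] this[of _ "- 1"] show ?thesis
    by (simp add: orthogonal_arrays_def Lah_l_bell Lah_L_bell)
qed

section \<open>Scaled Stirling numbers\<close>

definition half_expm1 :: "real fps" where
  "half_expm1 = fps_const (1 / 2) * (fps_exp 2 - 1)"

lemma half_expm1_nth_0 [simp]: "fps_nth half_expm1 0 = 0"
  by (simp add: half_expm1_def)

lemma half_expm1_deriv: "fps_deriv half_expm1 = 1 + fps_const 2 * half_expm1"
  by (simp add: half_expm1_def fps_eq_iff)

text \<open>The differential equation \<open>E' = 1 + 2 E\<close> gives \<open>(E ^ (m + 1))' = (m + 1) (E ^ m + 2 E ^ (m + 1))\<close>,
  which is the recurrence of the scaled Stirling numbers.\<close>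

lemma bell_half_expm1_Suc:
  "bell half_expm1 (Suc n) (Suc m)
     = bell half_expm1 n m + 2 * real (Suc m) * bell half_expm1 n (Suc m)"
proof -
  let ?E = half_expm1
  have "fps_deriv (?E ^ Suc m) = fps_const (real (Suc m)) * (?E ^ m + fps_const 2 * ?E ^ Suc m)"
    by (subst fps_deriv_power) (simp add: half_expm1_deriv algebra_simps)
  then have "fps_nth (fps_deriv (?E ^ Suc m)) n
      = real (Suc m) * (fps_nth (?E ^ m) n + 2 * fps_nth (?E ^ Suc m) n)"
    by (simp del: power_Suc)
  then have "real (Suc n) * fps_nth (?E ^ Suc m) (Suc n)
      = real (Suc m) * (fps_nth (?E ^ m) n + 2 * fps_nth (?E ^ Suc m) n)"
    by (simp del: power_Suc)
  then have "fact n / fact (Suc m) * (real (Suc n) * fps_nth (?E ^ Suc m) (Suc n))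
      = fact n / fact (Suc m) * (real (Suc m) * (fps_nth (?E ^ m) n + 2 * fps_nth (?E ^ Suc m) n))"
    by (simp only:)
  then show ?thesis
    by (simp add: bell_def field_simps del: power_Suc of_nat_Suc)
qed

lemma scaled_Stirling_bell: "scaled_Stirling n m = bell half_expm1 n m"
proof (induction n arbitrary: m)
  case 0
  show ?case
    by (cases m) (simp_all add: scaled_Stirling_def bell_def fps_power_zeroth)
next
  case (Suc n)
  show ?case
  proof (cases m)
    case 0
    then show ?thesis by (simp add: scaled_Stirling_def bell_def)
  next
    case (Suc k)
    have "2 * (2 ^ (n - Suc k) * real (Stirling n (Suc k))) = 2 ^ (n - k) * real (Stirling n (Suc k))"
      by (cases "n > k") (simp_all add: Suc_diff_Suc flip: power_Suc)
    moreover have "scaled_Stirling (Suc n) (Suc k)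
        = scaled_Stirling n k + real (Suc k) * (2 ^ (n - k) * real (Stirling n (Suc k)))"
      by (simp add: scaled_Stirling_def algebra_simps)
    ultimately have "scaled_Stirling (Suc n) (Suc k)
        = scaled_Stirling n k + 2 * real (Suc k) * scaled_Stirling n (Suc k)"
      by (simp only: scaled_Stirling_def mult.left_commute mult.assoc)
    then show ?thesis
      by (simp add: Suc Suc.IH bell_half_expm1_Suc)
  qed
qed

section \<open>The hyperbolic tangent\<close>

lemma fps_cosh_nz: "fps_cosh \<noteq> 0"
  by (auto simp: fps_cosh_def fps_eq_iff intro!: exI[of _ 0])

lemma fps_tanh_mult_cosh: "fps_tanh * fps_cosh = fps_sinh"
proof -
  have "fps_nth fps_cosh 0 \<noteq> 0" by (simp add: fps_cosh_def)
  then show ?thesis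
    by (simp add: fps_tanh_def fps_divide_unit mult.assoc inverse_mult_eq_1)
qed

text \<open>Multiplying numerator and denominator of \<open>sinh u / cosh u\<close> by \<open>exp u\<close>.\<close>

lemma fps_tanh_eq: "fps_tanh = fps_compose (moebius (- 1)) half_expm1"
proof -
  let ?h = "fps_compose (moebius (- 1)) half_expm1"
  have e: "fps_exp 1 * fps_exp (- 1) = (1 :: real fps)" "fps_exp 1 * fps_exp 1 = (fps_exp 2 :: real fps)"
    by (simp_all flip: fps_exp_add_mult)
  have s: "fps_exp 1 * fps_sinh = half_expm1"
    unfolding fps_sinh_def half_expm1_def
    by (subst mult.left_commute) (simp only: right_diff_distrib e)
  have "1 + half_expm1 = fps_const (1 / 2) * (fps_exp 2 + 1)"
    by (simp add: half_expm1_def fps_eq_iff)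
  then have c: "fps_exp 1 * fps_cosh = 1 + half_expm1"
    unfolding fps_cosh_def by (subst mult.left_commute) (simp only: distrib_left e)
  have "?h * (1 + half_expm1) = half_expm1"
    using compose_moebius_mult[of half_expm1 "- 1"] by (simp flip: fps_const_neg)
  then have "fps_exp 1 * fps_cosh * ?h = fps_exp 1 * fps_cosh * fps_tanh"
    by (metis c s fps_tanh_mult_cosh mult.assoc mult.commute)
  moreover have "fps_exp 1 * fps_cosh \<noteq> 0"
    by (metis fps_cosh_nz fps_exp_neq_0 mult_eq_0_iff)
  ultimately show ?thesis by simp
qed

lemma fps_tanh_nth_0 [simp]: "fps_nth fps_tanh 0 = 0"
  by (simp add: fps_tanh_eq)

lemma half_expm1_eq: "half_expm1 = fps_compose (moebius 1) fps_tanh"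
proof -
  have "fps_compose (moebius 1) fps_tanh
      = fps_compose (fps_compose (moebius 1) (moebius (- 1))) half_expm1"
    by (simp add: fps_tanh_eq fps_compose_assoc)
  then show ?thesis
    by (simp add: moebius_compose_moebius)
qed

lemma Theta_bell: "Theta n m = bell fps_tanh n m"
  by (simp add: Theta_def bell_def)

lemma fps_tanh_odd: "fps_compose fps_tanh (- fps_X) = - fps_tanh"
proof -
  have s: "fps_compose fps_sinh (- fps_X) = - fps_sinh"
    and c: "fps_compose fps_cosh (- fps_X) = fps_cosh"
    by (simp_all add: fps_sinh_def fps_cosh_def fps_compose_mult_distrib fps_compose_add_distrib
        fps_compose_sub_distrib algebra_simps)
  have "fps_compose (fps_tanh * fps_cosh) (- fps_X) = - (fps_tanh * fps_cosh)"
    by (simp only: fps_tanh_mult_cosh s)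
  then have "fps_compose fps_tanh (- fps_X) * fps_cosh = - fps_tanh * fps_cosh"
    by (simp add: fps_compose_mult_distrib c)
  then show ?thesis
    using fps_cosh_nz by (metis mult_right_cancel)
qed

lemma Theta_even_eq_0:
  assumes "even n"
  shows "Theta n 1 = 0"
proof -
  have "fps_nth fps_tanh n = - fps_nth fps_tanh n"
    using arg_cong[OF fps_tanh_odd, of "\<lambda>f. fps_nth f n"] assms
    by (simp add: fps_compose_uminus')
  then show ?thesis by (simp add: Theta_def)
qed

section \<open>The inverse pair and its first column\<close>

lemma Theta_Stirling_inverse: "inverse_relations Lah_l Lah_L Theta scaled_Stirling"
proof -
  have "Theta n m = (\<Sum>i=1..n. Lah_L i m * scaled_Stirling n i)" if "m \<ge> 1" for n m
    using that
    by (simp add: Theta_bell scaled_Stirling_bell Lah_L_bell fps_tanh_eq bell_compose)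
  moreover have "scaled_Stirling n m = (\<Sum>i=1..n. Lah_l i m * Theta n i)" if "m \<ge> 1" for n m
    using that
    by (simp add: Theta_bell scaled_Stirling_bell Lah_l_bell half_expm1_eq bell_compose)
  ultimately show ?thesis
    unfolding inverse_relations_def using orthogonal_Lah by blast
qed

theorem mainTheorem7:
  shows
    "(\<forall>n\<ge>1. (\<Sum>i=1..n. (- 1) ^ (i - 1) * fact i * scaled_Stirling n i)
              = (if even n then 0 else Theta n 1)) \<and>
     (\<forall>n\<ge>1. (2::real) ^ (n - 1) = (\<Sum>i=1..n. fact i * Theta n i)) \<and>
     inverse_relations Lah_l Lah_L Theta scaled_Stirling \<and>
     (\<forall>n\<ge>1. even n \<longrightarrow> Theta n 1 = 0) \<and>
     (\<forall>n\<ge>1. scaled_Stirling n 1 = 2 ^ (n - 1)) \<and>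
     (\<forall>i\<ge>1. Lah_L i 1 = (- 1) ^ (i - 1) * fact i) \<and>
     (\<forall>i\<ge>1. Lah_l i 1 = fact i)"
proof -
  have S1: "scaled_Stirling n 1 = 2 ^ (n - 1)" if "n \<ge> 1" for n
    using that by (cases n) (simp_all add: scaled_Stirling_def del: Stirling.simps)
  have l1: "Lah_l i 1 = fact i" for i
    by (simp add: Lah_l_def)
  have L1: "Lah_L i 1 = (- 1) ^ (i - 1) * fact i" for i
    by (simp only: Lah_L_def l1)
  have col: "Theta n 1 = (\<Sum>i=1..n. Lah_L i 1 * scaled_Stirling n i)"
    "scaled_Stirling n 1 = (\<Sum>i=1..n. Lah_l i 1 * Theta n i)" if "n \<ge> 1" for n
    using Theta_Stirling_inverse that unfolding inverse_relations_def by blast+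
  have "(\<Sum>i=1..n. (- 1) ^ (i - 1) * fact i * scaled_Stirling n i)
      = (if even n then 0 else Theta n 1)" if "n \<ge> 1" for n
    using col(1)[OF that] Theta_even_eq_0[of n] unfolding L1 by presburger
  moreover have "(2::real) ^ (n - 1) = (\<Sum>i=1..n. fact i * Theta n i)" if "n \<ge> 1" for n
    using col(2)[OF that] unfolding l1 S1[OF that] .
  ultimately show ?thesis
    using Theta_Stirling_inverse Theta_even_eq_0 S1 l1 L1 by blast
qed

end
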